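(* Let $T$ be any monotone tree poset of height $3$. Then $$La_{rp}(n,T)=\left(2+O_T\left(\sqrt{\frac{\log n}{n}}\right)\right)\binom{n}{\lfloor n/2\rfloor},$$ i.e., there is a constant $C_T$ depending only on $T$ such that for all sufficiently large $n$, $$\left|\frac{La_{rp}(n,T)}{\binom{n}{\lfloor n/2\rfloor}}-2\right|\le C_T\sqrt{\frac{\log n}{n}}.$$
   Context: For a finite poset $P$, its Hasse diagram is the graph on the elements of $P$ in which $x,y$ are adjacent if $x<y$ and there is no $z\in P$ with $x<z<y$. A tree poset is a poset whose Hasse diagram is a tree. A tree poset is monotone increasing if it has a unique minimal element, monotone decreasing if it has a unique maximal element, and monotone if it is either. The height of a poset is the maximum number of elements in a chain. A poset $P$ is graded with rank function $\rho$ if $\rho(y)=\rho(x)+1$ whenever $y$ covers $x$ (for a tree poset such a rank function exists and is determined up to an additive constant). For a family $\mathcal F$ of subsets of $[n]=\{1,\dots,n\}$, a subfamily $\mathcal G\subseteq\mathcal F$ is a rank-preserving copy of the graded poset $P$ if there is a bijection $\phi:P\to\mathcal G$ such that $\phi(x)\subseteq\phi(y)$ whenever $x\le_P y$, and $|\phi(x)|=|\phi(y)|$ whenever $\rho(x)=\rho(y)$. $La_{rp}(n,P)$ denotes the maximum size of a family $\mathcal F\subseteq 2^{[n]}$ containing no rank-preserving copy of $P$. *)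

theory Defs
  imports Complex_Main
begin

text \<open>
  A finite poset is given by its carrier \<open>P\<close> and its reflexive order relation \<open>r\<close>,
  so that \<open>x \<le>\<^sub>P y\<close> is \<open>(x, y) \<in> r\<close>.
\<close>

definition finite_poset :: "'a set \<Rightarrow> 'a rel \<Rightarrow> bool" where
  "finite_poset P r \<longleftrightarrow> finite P \<and> partial_order_on P r"

definition covers :: "'a set \<Rightarrow> 'a rel \<Rightarrow> 'a \<Rightarrow> 'a \<Rightarrow> bool" where
  "covers P r y x \<longleftrightarrow>
     x \<in> P \<and> y \<in> P \<and> (x, y) \<in> r \<and> x \<noteq> y \<and>
     \<not> (\<exists>z\<in>P. (x, z) \<in> r \<and> x \<noteq> z \<and> (z, y) \<in> r \<and> z \<noteq> y)"

text \<open>The edge set of an undirected graph is represented as a symmetric relation.\<close>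

definition hasse_diagram :: "'a set \<Rightarrow> 'a rel \<Rightarrow> 'a rel" where
  "hasse_diagram P r = {(x, y). covers P r y x \<or> covers P r x y}"

definition graph_cycle :: "'a rel \<Rightarrow> 'a list \<Rightarrow> bool" where
  "graph_cycle E vs \<longleftrightarrow>
     3 \<le> length vs \<and> distinct vs \<and>
     successively (\<lambda>u v. (u, v) \<in> E) vs \<and> (last vs, hd vs) \<in> E"

definition graph_tree :: "'a set \<Rightarrow> 'a rel \<Rightarrow> bool" where
  "graph_tree V E \<longleftrightarrow>
     V \<noteq> {} \<and> (\<forall>u\<in>V. \<forall>v\<in>V. (u, v) \<in> E\<^sup>*) \<and> \<not> (\<exists>vs. graph_cycle E vs)"

definition tree_poset :: "'a set \<Rightarrow> 'a rel \<Rightarrow> bool" where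
  "tree_poset P r \<longleftrightarrow> finite_poset P r \<and> graph_tree P (hasse_diagram P r)"

definition minimal_element :: "'a set \<Rightarrow> 'a rel \<Rightarrow> 'a \<Rightarrow> bool" where
  "minimal_element P r m \<longleftrightarrow> m \<in> P \<and> (\<forall>x\<in>P. (x, m) \<in> r \<longrightarrow> x = m)"

definition maximal_element :: "'a set \<Rightarrow> 'a rel \<Rightarrow> 'a \<Rightarrow> bool" where
  "maximal_element P r m \<longleftrightarrow> m \<in> P \<and> (\<forall>x\<in>P. (m, x) \<in> r \<longrightarrow> x = m)"

definition monotone_increasing_tree :: "'a set \<Rightarrow> 'a rel \<Rightarrow> bool" where
  "monotone_increasing_tree P r \<longleftrightarrow> tree_poset P r \<and> (\<exists>!m. minimal_element P r m)"

definition monotone_decreasing_tree :: "'a set \<Rightarrow> 'a rel \<Rightarrow> bool" where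
  "monotone_decreasing_tree P r \<longleftrightarrow> tree_poset P r \<and> (\<exists>!m. maximal_element P r m)"

definition monotone_tree :: "'a set \<Rightarrow> 'a rel \<Rightarrow> bool" where
  "monotone_tree P r \<longleftrightarrow> monotone_increasing_tree P r \<or> monotone_decreasing_tree P r"

definition poset_height :: "'a set \<Rightarrow> 'a rel \<Rightarrow> nat" where
  "poset_height P r = Max (card ` {C. C \<subseteq> P \<and> C \<in> Chains r})"

definition rank_function :: "'a set \<Rightarrow> 'a rel \<Rightarrow> ('a \<Rightarrow> int) \<Rightarrow> bool" where
  "rank_function P r \<rho> \<longleftrightarrow> (\<forall>x y. covers P r y x \<longrightarrow> \<rho> y = \<rho> x + 1)"

text \<open>
  A copy is taken with respect to some rank function. For a connected poset, in
  particular a tree poset, rank functions differ only by additive constants, and the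
  condition on \<open>\<phi>\<close> does not change under such a shift, so the choice is immaterial.
\<close>

definition rank_preserving_copy :: "'a set \<Rightarrow> 'a rel \<Rightarrow> nat set set \<Rightarrow> bool" where
  "rank_preserving_copy P r \<G> \<longleftrightarrow>
     (\<exists>\<rho> \<phi>. rank_function P r \<rho> \<and> bij_betw \<phi> P \<G> \<and>
        (\<forall>x\<in>P. \<forall>y\<in>P. (x, y) \<in> r \<longrightarrow> \<phi> x \<subseteq> \<phi> y) \<and>
        (\<forall>x\<in>P. \<forall>y\<in>P. \<rho> x = \<rho> y \<longrightarrow> card (\<phi> x) = card (\<phi> y)))"

definition La_rp :: "nat \<Rightarrow> 'a set \<Rightarrow> 'a rel \<Rightarrow> nat" where
  "La_rp n P r =
     Max (card ` {\<F>. \<F> \<subseteq> Pow {1..n} \<and> \<not> (\<exists>\<G>. \<G> \<subseteq> \<F> \<and> rank_preserving_copy P r \<G>)})"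

end

theory Submission
  imports
    Defs
    "HOL-Probability.Hoeffding"
    "HOL-Combinatorics.Multiset_Permutations"
    "HOL-Real_Asymp.Real_Asymp"
begin

text \<open>
  The lower bound comes from two middle levels, which contain no chain of length 3. For the upper bound,
  passing to complements we may assume that \<open>T\<close> has a least element. Put \<open>K = |T|\<close>, keep only the sets of a
  \<open>T\<close>-free family \<open>\<F>\<close> on the \<open>L = O(sqrt (n ln n))\<close> levels around \<open>n / 2\<close> (Hoeffding), and let \<open>G\<close> consist of the
  \<open>B \<in> \<F>\<close> with at least \<open>K\<close> proper supersets in \<open>\<F>\<close> on a single level \<open>l\<close>. A set with at least \<open>K\<close> supersets
  in \<open>G\<close> on one level and with the same \<open>l\<close> would be the root of a greedily embedded copy of \<open>T\<close>.
  Hence a set in \<open>\<F> - G\<close> has fewer than \<open>K\<close> supersets in \<open>\<F>\<close> on each level, and a set in \<open>G\<close> has at most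
  \<open>K * L\<close> supersets in \<open>G\<close> on each level. A random maximal chain through such a set meets one of these
  supersets with probability \<open>O(K * L / n)\<close>: a fixed superset \<open>d\<close> levels higher is met with probability
  \<open>O(1 / n)\<close> if \<open>d = 1\<close> and \<open>O(1 / n^2)\<close> if \<open>d \<ge> 2\<close>. A chain in \<open>\<F>\<close> without such pairs has at most one
  element in \<open>G\<close> and at most one further element, which bounds the Lubell mass of \<open>\<F>\<close> by \<open>2 + O(L / n)\<close>.
\<close>

section \<open>Permutations as maximal chains, and the Lubell mass\<close>

lemma perms_prefix_eq_append:
  assumes "finite S" "A \<subseteq> S"
  shows "{xs \<in> permutations_of_set S. set (take (card A) xs) = A} =
    (\<lambda>(ys, zs). ys @ zs) ` (permutations_of_set A \<times> permutations_of_set (S - A))" (is "?L = ?R")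
proof
  show "?L \<subseteq> ?R"
  proof
    fix xs assume "xs \<in> ?L"
    then have xs: "set xs = S" "distinct xs" and A: "set (take (card A) xs) = A"
      by (auto simp: permutations_of_set_def)
    have "take (card A) xs \<in> permutations_of_set A"
      using xs A by (auto simp: permutations_of_set_def)
    moreover have "set (drop (card A) xs) = S - A"
    proof -
      have "distinct (take (card A) xs @ drop (card A) xs)"
        using xs by simp
      then have "A \<inter> set (drop (card A) xs) = {}"
        unfolding distinct_append A by simp
      moreover have "A \<union> set (drop (card A) xs) = S"
        using xs A by (metis append_take_drop_id set_append)
      ultimately show ?thesis by blast
    qed
    then have "drop (card A) xs \<in> permutations_of_set (S - A)"
      using xs by (auto simp: permutations_of_set_def)
    ultimately show "xs \<in> ?R"
      by (intro image_eqI[of _ _ "(take (card A) xs, drop (card A) xs)"]) auto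
  qed
next
  show "?R \<subseteq> ?L"
    using assms by (auto simp: permutations_of_set_def distinct_card)
qed

text \<open>Such a permutation lists \<open>A\<close>, then \<open>B - A\<close>, then
  \<open>S - B\<close>, in independent orders, whence the three factorials. These are the maximal
  chains through both \<open>A\<close> and \<open>B\<close>.\<close>

lemma card_perms_prefix_prefix:
  assumes "finite S" "A \<subseteq> B" "B \<subseteq> S"
  shows "card {xs \<in> permutations_of_set S. set (take (card A) xs) = A \<and> set (take (card B) xs) = B}
    = fact (card A) * fact (card B - card A) * fact (card S - card B)"
proof -
  have fin: "finite A" "finite B"
    using assms by (auto intro: finite_subset)
  have le: "card A \<le> card B"
    using assms fin by (simp add: card_mono)
  let ?PB = "{ys \<in> permutations_of_set B. set (take (card A) ys) = A}"
  \<comment> \<open>The cut point is recoverable because all enumerations of \<open>X\<close> have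
    the same length.\<close>
  have inj: "inj_on (\<lambda>(ys, zs). ys @ zs) (permutations_of_set X \<times> Y)" for X :: "'a set" and Y
    proof (rule inj_onI, clarify)
    fix ys zs ys' zs' :: "'a list"
    assume *: "ys \<in> permutations_of_set X" "ys' \<in> permutations_of_set X" "ys @ zs = ys' @ zs'"
    then have "length ys = length ys'"
      by (simp add: length_finite_permutations_of_set)
    with * show "ys = ys' \<and> zs = zs'"
      by simp
  qed
  have "card ?PB = card (permutations_of_set A \<times> permutations_of_set (B - A))"
    using perms_prefix_eq_append[OF fin(2) assms(2)] by (simp add: card_image inj)
  then have PB: "card ?PB = fact (card A) * fact (card B - card A)"
    using fin assms by (simp add: card_cartesian_product card_Diff_subset)
  have "{xs \<in> permutations_of_set S. set (take (card A) xs) = A \<and> set (take (card B) xs) = B}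
      = {xs \<in> {xs \<in> permutations_of_set S. set (take (card B) xs) = B}. set (take (card A) xs) = A}"
    by auto
  also have "\<dots> = (\<lambda>(ys, zs). ys @ zs) ` (?PB \<times> permutations_of_set (S - B))"
  proof -
    have "set (take (card A) (ys @ zs)) = set (take (card A) ys)" if "ys \<in> permutations_of_set B" for ys zs
      using length_finite_permutations_of_set[OF that] le by simp
    then show ?thesis
      unfolding perms_prefix_eq_append[OF assms(1,3)] by (auto simp del: take_append)
  qed
  also have "card \<dots> = card ?PB * card (permutations_of_set (S - B))"
  proof (subst card_image)
    show "inj_on (\<lambda>(ys, zs). ys @ zs) (?PB \<times> permutations_of_set (S - B))"
      by (rule inj_on_subset[OF inj[of B "permutations_of_set (S - B)"]]) auto
  qed (rule card_cartesian_product)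
  finally show ?thesis
    using PB fin assms by (simp add: card_Diff_subset)
qed

lemma fact_binomial_binomial:
  assumes "a \<le> b" "b \<le> n"
  shows "real (fact a * fact (b - a) * fact (n - b)) / fact n
    = 1 / (real (n choose a) * real ((n - a) choose (b - a)))"
proof -
  have "real (n choose a) = fact n / (fact a * fact (n - a))"
    using assms by (intro binomial_fact) simp
  moreover have "real ((n - a) choose (b - a)) = fact (n - a) / (fact (b - a) * fact (n - b))"
    using assms binomial_fact[of "b - a" "n - a", where 'a = real] by simp
  ultimately show ?thesis
    by simp
qed

text \<open>For a family of subsets of an \<open>n\<close>-element set, this is the expected number
  of members on a uniformly random maximal chain.\<close>

definition lubell :: "nat \<Rightarrow> 'a set set \<Rightarrow> real" where
  "lubell n \<F> = (\<Sum>A\<in>\<F>. 1 / real (n choose card A))"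

text \<open>
  Average the hypothesis on chains over the maximal chains of the power set, a maximal chain being the set
  of prefixes of a permutation. The chain passes through \<open>A \<subseteq> B\<close> with probability
  \<open>1 / ((n choose |A|) * (n - |A| choose |B| - |A|))\<close>.
\<close>

lemma lubell_le_chain_pairs:
  fixes \<F> :: "'a set set" and E :: "('a set \<times> 'a set) set" and q :: nat
  assumes S: "finite S" "\<F> \<subseteq> Pow S"
    and E: "E \<subseteq> {(A, B). A \<in> \<F> \<and> B \<in> \<F> \<and> A \<subseteq> B}"
    and chain: "\<And>C. \<lbrakk>C \<subseteq> \<F>; \<And>A B. \<lbrakk>A \<in> C; B \<in> C\<rbrakk> \<Longrightarrow> A \<subseteq> B \<or> B \<subseteq> A\<rbrakk>
      \<Longrightarrow> card C \<le> q + card (E \<inter> C \<times> C)"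
  shows "lubell (card S) \<F> \<le> q +
    (\<Sum>(A, B)\<in>E. 1 / (real (card S choose card A) * real ((card S - card A) choose (card B - card A))))"
proof -
  define n where "n = card S"
  define \<Omega> where "\<Omega> = permutations_of_set S"
  define on where "on = (\<lambda>xs (A :: 'a set). set (take (card A) xs) = A)"
  have fin: "finite \<F>" "finite E" "finite \<Omega>"
  proof -
    show "finite \<F>"
      using S by (auto intro: finite_subset)
    then have "finite (\<F> \<times> \<F>)"
      by simp
    then show "finite E"
      using E by (rule_tac finite_subset[of E "\<F> \<times> \<F>"]) auto
    show "finite \<Omega>"
      by (simp add: \<Omega>_def)
  qed
  have card_\<Omega>: "card \<Omega> = fact n"
    using S by (simp add: \<Omega>_def n_def)
  have pair: "real (card {xs \<in> \<Omega>. on xs A \<and> on xs B}) / fact n =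
      1 / (real (n choose card A) * real ((n - card A) choose (card B - card A)))"
    if "A \<subseteq> B" "B \<in> \<F>" for A B
  proof -
    have B: "B \<subseteq> S"
      using that S by auto
    have "card A \<le> card B" "card B \<le> n"
      using that B S unfolding n_def by (auto intro: card_mono finite_subset)
    then show ?thesis
      unfolding \<Omega>_def on_def card_perms_prefix_prefix[OF S(1) that(1) B] n_def[symmetric]
      by (rule fact_binomial_binomial)
  qed
  \<comment> \<open>With \<open>A = B\<close> the second binomial is \<open>1\<close>.\<close>
  have single: "real (card {xs \<in> \<Omega>. on xs A}) / fact n = 1 / real (n choose card A)" if "A \<in> \<F>" for A
    using pair[of A A] that by simp
  \<comment> \<open>Incidences between members of the family and permutations are counted in both
    orders.\<close>
  have "lubell n \<F> * fact n = (\<Sum>A\<in>\<F>. real (card {xs \<in> \<Omega>. on xs A}))"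
    unfolding lubell_def sum_distrib_right using single
    by (intro sum.cong) (auto simp: field_simps)
  also have "\<dots> = real (\<Sum>xs\<in>\<Omega>. card {A \<in> \<F>. on xs A})"
    using sum.swap_restrict[OF fin(1) fin(3), of "\<lambda>_ _. 1 :: nat" "\<lambda>A xs. on xs A"]
    by (simp flip: of_nat_sum)
  also have "\<dots> \<le> real (\<Sum>xs\<in>\<Omega>. q + card {p \<in> E. on xs (fst p) \<and> on xs (snd p)})"
  proof (intro of_nat_mono sum_mono)
    fix xs
    let ?C = "{A \<in> \<F>. on xs A}"
    \<comment> \<open>Prefixes of one list are nested, so the members met by \<open>xs\<close> form
      a chain.\<close>
    have "A \<subseteq> B \<or> B \<subseteq> A" if "A \<in> ?C" "B \<in> ?C" for A B
      using that nle_le[of "card A" "card B"] set_take_subset_set_take[of "card A" "card B" xs]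
        set_take_subset_set_take[of "card B" "card A" xs]
      unfolding on_def by auto
    then have "card ?C \<le> q + card (E \<inter> ?C \<times> ?C)"
      by (intro chain) auto
    also have "E \<inter> ?C \<times> ?C = {p \<in> E. on xs (fst p) \<and> on xs (snd p)}"
      using E by auto
    finally show "card ?C \<le> q + card {p \<in> E. on xs (fst p) \<and> on xs (snd p)}" .
  qed
  also have "\<dots> = q * fact n + real (\<Sum>xs\<in>\<Omega>. card {p \<in> E. on xs (fst p) \<and> on xs (snd p)})"
    using card_\<Omega> by (simp add: sum.distrib algebra_simps)
  also have "(\<Sum>xs\<in>\<Omega>. card {p \<in> E. on xs (fst p) \<and> on xs (snd p)})
      = (\<Sum>p\<in>E. card {xs \<in> \<Omega>. on xs (fst p) \<and> on xs (snd p)})"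
    using sum.swap_restrict[OF fin(2) fin(3), of "\<lambda>_ _. 1 :: nat" "\<lambda>p xs. on xs (fst p) \<and> on xs (snd p)"]
    by simp
  also have "real \<dots> = (\<Sum>(A, B)\<in>E. 1 / (real (n choose card A) * real ((n - card A) choose (card B - card A)))) * fact n"
    unfolding sum_distrib_right of_nat_sum
  proof (intro sum.cong refl)
    fix p assume "p \<in> E"
    then show "real (card {xs \<in> \<Omega>. on xs (fst p) \<and> on xs (snd p)}) =
        (case p of (A, B) \<Rightarrow> 1 / (real (n choose card A) * real ((n - card A) choose (card B - card A)))) * fact n"
      using E pair[of "fst p" "snd p"] by (auto simp: field_simps)
  qed
  finally have "lubell n \<F> * fact n \<le> (q + (\<Sum>(A, B)\<in>E. 1 / (real (n choose card A) *
      real ((n - card A) choose (card B - card A))))) * fact n"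
    by (simp add: algebra_simps)
  then show ?thesis
    unfolding n_def[symmetric] by simp
qed

section \<open>The Lubell mass of a family without branching\<close>

text \<open>Binomials grow towards the middle of their row, and past the middle symmetry replaces
  \<open>d\<close> by \<open>m - d\<close>. With \<open>r = 1\<close> and \<open>r = 2\<close> this
  bounds the chance that a chain through a set meets a given superset \<open>d\<close> levels
  higher.\<close>

lemma binomial_le_binomial_between:
  assumes "r \<le> d" "d + r \<le> m" "M \<le> m"
  shows "M choose r \<le> m choose d"
proof -
  have "m choose r \<le> m choose d"
  proof (cases "2 * d \<le> m")
    case True
    then show ?thesis
      using assms by (intro binomial_mono) auto
  next
    case False
    then have "m choose r \<le> m choose (m - d)"
      using assms by (intro binomial_mono) auto
    then show ?thesis
      using assms binomial_symmetric[of d m] by simp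
  qed
  with assms show ?thesis
    using binomial_right_mono[of M m r] by linarith
qed

text \<open>Levels are kept apart because a rank-preserving copy sends elements of equal rank to
  sets of equal size.\<close>

definition level_above :: "'a set set \<Rightarrow> 'a set \<Rightarrow> nat \<Rightarrow> 'a set set" where
  "level_above \<F> A j = {B \<in> \<F>. A \<subset> B \<and> card B = j}"

text \<open>A maximal member of a finite chain is its greatest. With \<open>m \<in> D\<close> under
  the quantifier, the empty chain is covered by an arbitrary \<open>m\<close>, so uses need no case
  split.\<close>

lemma finite_chain_max:
  assumes "finite D" and "\<And>A B. \<lbrakk>A \<in> D; B \<in> D\<rbrakk> \<Longrightarrow> A \<subseteq> B \<or> B \<subseteq> A"
  shows "\<exists>m. \<forall>A \<in> D - {m}. A \<subset> m \<and> m \<in> D"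
proof (cases "D = {}")
  case False
  then obtain m where "m \<in> D" "\<forall>b\<in>D. m \<subseteq> b \<longrightarrow> m = b"
    using finite_has_maximal[OF assms(1)] by blast
  then have "A \<subset> m \<and> m \<in> D" if "A \<in> D - {m}" for A
    using assms(2)[of A m] that by auto
  then show ?thesis
    by blast
qed simp

text \<open>For each lower member \<open>A\<close>, the pairs in \<open>E\<close> have conditional
  weight at most the bracketed factor. Summing over \<open>A\<close> reproduces the Lubell mass,
  which therefore stands on both sides.\<close>

lemma lubell_no_branching:
  fixes S :: "'a set"
  assumes S: "finite S" "\<F> \<subseteq> Pow S"
    and I: "finite I" "card ` \<F> \<subseteq> I" "\<And>i. i \<in> I \<Longrightarrow> i + M \<le> card S" and M: "2 \<le> M"
    and free: "\<And>A j l. A \<in> \<F> \<Longrightarrow> card {B \<in> level_above \<F> A j. K \<le> card (level_above \<F> B l)} < K"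
  shows "lubell (card S) \<F> \<le> 2 + lubell (card S) \<F> *
    (K * card I / M + K * (card I)\<^sup>2 / (M choose 2))"
proof -
  define n where "n = card S"
  define G where "G = {A \<in> \<F>. \<exists>l. K \<le> card (level_above \<F> A l)}"
  \<comment> \<open>Only pairs rising from \<open>G\<close> to its complement are left out. A chain
    without pairs in \<open>E\<close> thus has at most one member in \<open>G\<close> and at most
    one outside it.\<close>
  define E where "E = {(A, B). A \<in> \<F> \<and> B \<in> \<F> \<and> A \<subset> B \<and> (A \<in> G \<longrightarrow> B \<in> G)}"
  define \<epsilon> where "\<epsilon> = K * card I / M + K * (card I)\<^sup>2 / (M choose 2)"
  have fin\<F>: "finite \<F>"
    using S by (auto intro: finite_subset)
  have finE: "finite (E `` {A})" for A
    by (rule finite_subset[OF _ fin\<F>]) (auto simp: E_def)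
  have finabove: "finite (level_above \<F> A j)" for A j
    using fin\<F> by (simp add: level_above_def)
  have chain: "card C \<le> 2 + card (E \<inter> C \<times> C)"
    if C: "C \<subseteq> \<F>" "\<And>A B. \<lbrakk>A \<in> C; B \<in> C\<rbrakk> \<Longrightarrow> A \<subseteq> B \<or> B \<subseteq> A" for C
  proof -
    have finC: "finite C"
      using C(1) fin\<F> by (rule finite_subset)
    obtain m where m: "\<forall>A \<in> C - {m}. A \<subset> m \<and> m \<in> C"
      using finite_chain_max[OF finC C(2)] by blast
    have "\<exists>m'. \<forall>A \<in> C \<inter> G - {m'}. A \<subset> m' \<and> m' \<in> C \<inter> G"
      by (rule finite_chain_max) (use finC C(2) in auto)
    then obtain m' where m': "\<forall>A \<in> C \<inter> G - {m'}. A \<subset> m' \<and> m' \<in> C \<inter> G"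
      by blast
    have "card C \<le> card (C - {m, m'}) + card {m, m'}"
      using card_Un_le[of "C - {m, m'}" "{m, m'}"] finC
      by (metis card_mono finite.emptyI finite.insertI finite_UnI le_trans Un_Diff_cancel2 Un_upper1)
    moreover have "card {m, m'} \<le> 2"
      by (simp add: card_insert_if)
    \<comment> \<open>Every member other than the two tops is the lower end of a pair in
      \<open>E\<close>: with \<open>m'\<close> if it lies in \<open>G\<close>, otherwise with
      \<open>m\<close>.\<close>
    moreover have "card (C - {m, m'}) \<le> card (E \<inter> C \<times> C)"
    proof (rule card_inj_on_le)
      show "inj_on (\<lambda>A. (A, if A \<in> G then m' else m)) (C - {m, m'})"
        by (auto simp: inj_on_def)
      show "(\<lambda>A. (A, if A \<in> G then m' else m)) ` (C - {m, m'}) \<subseteq> E \<inter> C \<times> C"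
      proof (rule image_subsetI)
        fix A assume A: "A \<in> C - {m, m'}"
        show "(A, if A \<in> G then m' else m) \<in> E \<inter> C \<times> C"
          using A C(1) bspec[OF m, of A] bspec[OF m', of A] unfolding E_def
          by (cases "A \<in> G") (simp_all add: subset_iff)
      qed
      show "finite (E \<inter> C \<times> C)"
        using finC by auto
    qed
    ultimately show ?thesis
      by linarith
  qed
  \<comment> \<open>The sum is the expected number of upper partners of \<open>A\<close> on a random
    maximal chain conditioned to pass through \<open>A\<close>.\<close>
  have above_weight: "(\<Sum>B\<in>E `` {A}. 1 / real ((n - card A) choose (card B - card A))) \<le> \<epsilon>"
    if A: "A \<in> \<F>" for A
  proof -
    have K: "0 < K"
      using free[OF A] by fastforce
    have sub: "E `` {A} \<subseteq> \<F>"
      by (auto simp: E_def)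
    \<comment> \<open>Both \<open>card A\<close> and \<open>j\<close> lie at least
      \<open>M \<ge> 2\<close> levels below the top, which supplies the side conditions on the
      binomials here and in \<open>M2\<close>.\<close>
    have M1: "real M \<le> real ((n - card A) choose (j - card A))" if "card A < j" "j \<in> I" for j
      using binomial_le_binomial_between[of 1 "j - card A" "n - card A" M] that I(3)[of j] I(3)[of "card A"] I(2) A M
      by (auto simp: n_def)
    have M2: "real (M choose 2) \<le> real ((n - card A) choose (j - card A))" if "card A + 2 \<le> j" "j \<in> I" for j
      using binomial_le_binomial_between[of 2 "j - card A" "n - card A" M] that I(3)[of j] I(3)[of "card A"] I(2) A M
      by (auto simp: n_def)
    have Mpos: "0 < real M" "0 < real (M choose 2)"
      using M by auto
    have level_empty: "{B \<in> E `` {A}. card B = j} = {}" if "j \<le> card A" for j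
    proof -
      have "card A < card B" if "B \<in> E `` {A}" for B
        using that S by (auto simp: E_def intro!: psubset_card_mono intro: finite_subset)
      then show ?thesis
        using that by fastforce
    qed
    have "(\<Sum>B\<in>E `` {A}. 1 / real ((n - card A) choose (card B - card A)))
       = (\<Sum>j\<in>I. \<Sum>B\<in>{B \<in> E `` {A}. card B = j}. 1 / real ((n - card A) choose (card B - card A)))"
      using sub I by (intro sum.group[symmetric] finE) auto
    also have "\<dots> = (\<Sum>j\<in>I. card {B \<in> E `` {A}. card B = j} / real ((n - card A) choose (j - card A)))"
      by (intro sum.cong) auto
    also have "\<dots> \<le> \<epsilon>"
    proof (cases "A \<in> G")
      \<comment> \<open>Outside \<open>G\<close> there are fewer than \<open>K\<close> supersets per
        level, so the weak weight \<open>1 / M\<close> suffices on all levels: this is the first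
        term of \<open>\<epsilon>\<close>.\<close>
      case False
      have "card {B \<in> E `` {A}. card B = j} / real ((n - card A) choose (j - card A)) \<le> K / M"
        if "j \<in> I" for j
      proof (cases "j \<le> card A")
        case True
        then show ?thesis
          by (simp add: level_empty del: Image_singleton_iff)
      next
        case j: False
        have "card {B \<in> E `` {A}. card B = j} \<le> card (level_above \<F> A j)"
          by (intro card_mono finabove) (auto simp: E_def level_above_def)
        also have "\<dots> \<le> K"
          using False A unfolding G_def by (auto simp: not_le intro: less_imp_le)
        finally show ?thesis
          using M1[of j] j that Mpos by (intro frac_le) auto
      qed
      then have "(\<Sum>j\<in>I. card {B \<in> E `` {A}. card B = j} / real ((n - card A) choose (j - card A)))
          \<le> of_nat (card I) * (K / M)"
        by (rule sum_bounded_above)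
      also have "\<dots> \<le> \<epsilon>"
        by (simp add: \<epsilon>_def mult.commute)
      finally show ?thesis .
    next
      case True
      let ?N = "real (card I * K)"
      \<comment> \<open>Every upper partner lies in \<open>G\<close>, witnessed by some level
        \<open>l\<close>. For fixed \<open>l\<close> the bound is \<open>free\<close>; the union
        over \<open>l\<close> costs the factor \<open>card I\<close>.\<close>
      have count: "real (card {B \<in> E `` {A}. card B = j}) \<le> ?N" for j
      proof -
        have "{B \<in> E `` {A}. card B = j} \<subseteq> (\<Union>l\<in>I. {B \<in> level_above \<F> A j. K \<le> card (level_above \<F> B l)})"
        proof
          fix B assume B: "B \<in> {B \<in> E `` {A}. card B = j}"
          then have "B \<in> G" "B \<in> level_above \<F> A j"
            using True by (auto simp: E_def level_above_def)
          then obtain l where l: "K \<le> card (level_above \<F> B l)"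
            by (auto simp: G_def)
          \<comment> \<open>Since \<open>K\<close> is positive, the witnessing level is occupied, so
            only levels in \<open>I\<close> occur.\<close>
          with K have "level_above \<F> B l \<noteq> {}"
            by auto
          then have "l \<in> I"
            using I(2) by (auto simp: level_above_def)
          with l \<open>B \<in> level_above \<F> A j\<close> show "B \<in> (\<Union>l\<in>I. {B \<in> level_above \<F> A j. K \<le> card (level_above \<F> B l)})"
            by blast
        qed
        then have "card {B \<in> E `` {A}. card B = j} \<le> card (\<Union>l\<in>I. {B \<in> level_above \<F> A j. K \<le> card (level_above \<F> B l)})"
          using I(1) finabove by (intro card_mono) auto
        also have "\<dots> \<le> (\<Sum>l\<in>I. card {B \<in> level_above \<F> A j. K \<le> card (level_above \<F> B l)})"
          using I(1) by (rule card_UN_le)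
        also have "\<dots> \<le> (\<Sum>l\<in>I. K)"
          by (intro sum_mono less_imp_le free A)
        finally show ?thesis
          by (simp flip: of_nat_mult)
      qed
      \<comment> \<open>The larger count is affordable because the weight \<open>1 / M\<close>
        occurs only on the level directly above \<open>A\<close>; higher levels have weight at most
        \<open>1 / (M choose 2)\<close>.\<close>
      have "(\<Sum>j\<in>I. card {B \<in> E `` {A}. card B = j} / real ((n - card A) choose (j - card A)))
          \<le> (\<Sum>j\<in>I. (if j = card A + 1 then ?N / M else 0) + ?N / (M choose 2))"
      proof (rule sum_mono)
        fix j assume j: "j \<in> I"
        consider "j \<le> card A" | "j = card A + 1" | "card A + 2 \<le> j"
          by linarith
        then show "card {B \<in> E `` {A}. card B = j} / real ((n - card A) choose (j - card A))
            \<le> (if j = card A + 1 then ?N / M else 0) + ?N / (M choose 2)"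
        proof cases
          case 1
          then show ?thesis
            by (simp add: level_empty del: Image_singleton_iff)
        next
          case 2
          then have "card {B \<in> E `` {A}. card B = j} / real ((n - card A) choose (j - card A)) \<le> ?N / M"
            using M1[of j] j Mpos by (intro frac_le count) auto
          moreover have "0 \<le> ?N / real (M choose 2)"
            by simp
          ultimately show ?thesis
            unfolding if_P[OF 2] by linarith
        next
          case 3
          then have "card {B \<in> E `` {A}. card B = j} / real ((n - card A) choose (j - card A)) \<le> ?N / (M choose 2)"
            using M2[of j] j Mpos by (intro frac_le count) auto
          then show ?thesis
            using 3 by simp
        qed
      qed
      also have "\<dots> \<le> ?N / M + card I * (?N / (M choose 2))"
        using I(1) by (simp add: sum.distrib sum.delta)
      also have "\<dots> = \<epsilon>"
        by (simp add: \<epsilon>_def power2_eq_square mult_ac)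
      finally show ?thesis .
    qed
    finally show ?thesis .
  qed
  have "lubell n \<F> \<le> 2 + (\<Sum>(A, B)\<in>E. 1 / (real (n choose card A) * real ((n - card A) choose (card B - card A))))"
    using lubell_le_chain_pairs[OF S, of E 2] chain unfolding n_def by (auto simp: E_def)
  also have "E = Sigma \<F> (\<lambda>A. E `` {A})"
    by (auto simp: E_def)
  also have "(\<Sum>(A, B)\<in>\<dots>. 1 / (real (n choose card A) * real ((n - card A) choose (card B - card A))))
      = (\<Sum>A\<in>\<F>. 1 / real (n choose card A) * (\<Sum>B\<in>E `` {A}. 1 / real ((n - card A) choose (card B - card A))))"
    using fin\<F> finE by (subst sum.Sigma[symmetric]) (auto simp: sum_distrib_left)
  also have "\<dots> \<le> (\<Sum>A\<in>\<F>. 1 / real (n choose card A) * \<epsilon>)"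
    by (intro sum_mono mult_left_mono above_weight) auto
  also have "\<dots> = lubell n \<F> * \<epsilon>"
    by (simp add: lubell_def sum_distrib_right)
  finally show ?thesis
    by (simp add: n_def \<epsilon>_def)
qed

section \<open>Embedding an increasing tree of height 3\<close>

text \<open>Greedy choice: when a further point is placed, fewer than \<open>k\<close> values are
  taken, so \<open>F x\<close> still has a free element.\<close>

lemma injective_choice:
  assumes "finite X" "card X \<le> k" "\<And>x. x \<in> X \<Longrightarrow> k \<le> card (F x)"
  shows "\<exists>f. inj_on f X \<and> (\<forall>x\<in>X. f x \<in> F x)"
  using assms
proof (induction X rule: finite_induct)
  case (insert x X)
  then obtain f where f: "inj_on f X" "\<forall>x\<in>X. f x \<in> F x"
    by auto
  have "card (f ` X) < card (F x)"
    using insert.prems(1) insert.prems(2)[of x] insert.hyps card_image_le[of X f] by simp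
  then obtain y where "y \<in> F x" "y \<notin> f ` X"
    using insert.hyps by (metis card_mono finite_imageI linorder_not_less subsetI)
  with f insert.hyps show ?case
    by (intro exI[of _ "f(x := y)"]) (auto simp: inj_on_def)
qed simp

text \<open>Among the elements below \<open>x\<close>, one with the smallest down-set is minimal and
  hence equals \<open>m\<close>.\<close>

lemma unique_minimal_element_least:
  assumes "finite_poset P r" "\<exists>!m. minimal_element P r m"
  obtains m where "m \<in> P" "\<And>x. x \<in> P \<Longrightarrow> (m, x) \<in> r"
proof -
  have fin: "finite P" and refl: "\<And>x. x \<in> P \<Longrightarrow> (x, x) \<in> r"
    and trans: "\<And>x y z. (x, y) \<in> r \<Longrightarrow> (y, z) \<in> r \<Longrightarrow> (x, z) \<in> r"
    and antisym: "\<And>x y. (x, y) \<in> r \<Longrightarrow> (y, x) \<in> r \<Longrightarrow> x = y"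
    using assms(1) unfolding finite_poset_def partial_order_on_def preorder_on_def
    by (auto dest: refl_onD transD antisymD)
  obtain m where m: "minimal_element P r m" and uniq: "\<And>m'. minimal_element P r m' \<Longrightarrow> m' = m"
    using assms(2) by blast
  have "(m, x) \<in> r" if "x \<in> P" for x
  proof -
    let ?down = "\<lambda>z. {w \<in> P. (w, z) \<in> r}"
    have "\<exists>z. (z \<in> P \<and> (z, x) \<in> r) \<and> (\<forall>y. y \<in> P \<and> (y, x) \<in> r \<longrightarrow> card (?down z) \<le> card (?down y))"
      by (rule ex_has_least_nat[of _ x]) (use that refl in auto)
    then obtain z where z: "z \<in> P" "(z, x) \<in> r"
      and least: "\<And>y. y \<in> P \<Longrightarrow> (y, x) \<in> r \<Longrightarrow> card (?down z) \<le> card (?down y)"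
      by blast
    have "minimal_element P r z"
      unfolding minimal_element_def
    proof (intro conjI z ballI impI)
      fix w assume w: "w \<in> P" "(w, z) \<in> r"
      show "w = z"
      proof (rule ccontr)
        assume "w \<noteq> z"
        with w z have "?down w \<subset> ?down z"
          using refl[of z] trans antisym by blast
        then have "card (?down w) < card (?down z)"
          using fin by (intro psubset_card_mono) auto
        then show False
          using least[OF w(1)] trans[OF w(2) z(2)] by simp
      qed
    qed
    then show ?thesis
      using uniq z by blast
  qed
  then show thesis
    using that m by (auto simp: minimal_element_def)
qed

lemma chain_card_le_height:
  assumes "finite P" "C \<subseteq> P" "C \<in> Chains r"
  shows "card C \<le> poset_height P r"
  unfolding poset_height_def using assms by (intro Max_ge) auto

lemma height_chain_exists:
  assumes "finite P"
  obtains C where "C \<subseteq> P" "C \<in> Chains r" "card C = poset_height P r"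
proof -
  have "{} \<in> {C. C \<subseteq> P \<and> C \<in> Chains r}"
    by (auto simp: Chains_def)
  then have "poset_height P r \<in> card ` {C. C \<subseteq> P \<and> C \<in> Chains r}"
    unfolding poset_height_def using assms by (intro Max_in) auto
  then show thesis
    using that by auto
qed

text \<open>The tree consists of a root \<open>m\<close>, its covers, and a top rank whose elements
  \<open>y\<close> have a single parent \<open>p y\<close>: the height excludes a fourth rank,
  acyclicity a second parent.\<close>

lemma increasing_tree_height_3_structure:
  assumes T: "monotone_increasing_tree T r" "poset_height T r = 3"
  obtains m p where "m \<in> T"
    "\<And>y. \<lbrakk>y \<in> T; y \<noteq> m; \<not> covers T r y m\<rbrakk> \<Longrightarrow> covers T r (p y) m"
    "\<And>x y. \<lbrakk>x \<in> T; y \<in> T; (x, y) \<in> r; x \<noteq> y; x \<noteq> m\<rbrakk> \<Longrightarrow> y \<noteq> m \<and> \<not> covers T r y m \<and> x = p y"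
proof -
  have poset: "finite_poset T r" and acyclic: "\<And>vs. \<not> graph_cycle (hasse_diagram T r) vs"
    and uniq: "\<exists>!m. minimal_element T r m"
    using T(1) by (auto simp: monotone_increasing_tree_def tree_poset_def graph_tree_def)
  obtain m where m: "m \<in> T" "\<And>x. x \<in> T \<Longrightarrow> (m, x) \<in> r"
    using unique_minimal_element_least[OF poset uniq] by blast
  have fin: "finite T" and refl: "\<And>x. x \<in> T \<Longrightarrow> (x, x) \<in> r"
    and trans: "\<And>x y z. (x, y) \<in> r \<Longrightarrow> (y, z) \<in> r \<Longrightarrow> (x, z) \<in> r"
    and antisym: "\<And>x y. (x, y) \<in> r \<Longrightarrow> (y, x) \<in> r \<Longrightarrow> x = y"
    using poset unfolding finite_poset_def partial_order_on_def preorder_on_def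
    by (auto dest: refl_onD transD antisymD)
  define lt where "lt = (\<lambda>x y. x \<in> T \<and> y \<in> T \<and> (x, y) \<in> r \<and> x \<noteq> y)"
  have lt_trans: "lt x z" if "lt x y" "lt y z" for x y z
    using that trans antisym unfolding lt_def by blast
  have no_chain4: False if "lt a b" "lt b c" "lt c d" for a b c d
  proof -
    have lts: "lt a c" "lt b d" "lt a d"
      using that lt_trans by blast+
    have "{a, b, c, d} \<in> Chains r"
      using that lts refl unfolding Chains_def lt_def by auto
    moreover have "{a, b, c, d} \<subseteq> T"
      using that by (auto simp: lt_def)
    ultimately have "card {a, b, c, d} \<le> 3"
      using chain_card_le_height[OF fin] T(2) by metis
    moreover have "card {a, b, c, d} = 4"
      using that lts by (simp add: lt_def)
    ultimately show False
      by simp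
  qed
  have cov: "covers T r y x \<longleftrightarrow> lt x y \<and> \<not> (\<exists>z. lt x z \<and> lt z y)" for x y
    unfolding covers_def lt_def by blast
  have m_lt: "lt m x" if "x \<in> T" "x \<noteq> m" for x
    using that m by (auto simp: lt_def)
  \<comment> \<open>As \<open>m\<close>, \<open>x\<close>, \<open>y\<close> already form a chain of
    three, any element strictly between two of them would give a chain of four.\<close>
  have middle: "covers T r x m" "covers T r y x" "\<not> covers T r y m" "y \<noteq> m" if "lt x y" "x \<noteq> m" for x y
  proof -
    have mx: "lt m x"
      using that m_lt[of x] by (simp add: lt_def)
    then show "covers T r x m" "covers T r y x" "\<not> covers T r y m"
      using that(1) no_chain4 unfolding cov by blast+
    show "y \<noteq> m"
      using lt_trans[OF mx that(1)] by (auto simp: lt_def)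
  qed
  have parent_unique: "x = x'" if "lt x y" "lt x' y" "x \<noteq> m" "x' \<noteq> m" for x x' y
  proof (rule ccontr)
    assume "x \<noteq> x'"
    moreover have "y \<noteq> m" "x \<noteq> y" "x' \<noteq> y"
      using middle(4) that by (auto simp: lt_def)
    \<comment> \<open>Two parents of \<open>y\<close> close a 4-cycle through the root.\<close>
    ultimately have "graph_cycle (hasse_diagram T r) [m, x, y, x']"
      using middle(1,2) that unfolding graph_cycle_def hasse_diagram_def by auto
    then show False
      using acyclic by blast
  qed
  define p where "p = (\<lambda>y. SOME x. lt x y \<and> x \<noteq> m)"
  have p: "lt (p y) y \<and> p y \<noteq> m" if "\<exists>x. lt x y \<and> x \<noteq> m" for y
    unfolding p_def using that by (rule someI_ex)
  show thesis
  proof (rule that[of m p])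
    fix y assume "y \<in> T" "y \<noteq> m" "\<not> covers T r y m"
    then have "\<exists>x. lt x y \<and> x \<noteq> m"
      using m_lt cov by (metis lt_def)
    then show "covers T r (p y) m"
      using p middle(1) by blast
  next
    fix x y assume "x \<in> T" "y \<in> T" "(x, y) \<in> r" "x \<noteq> y" "x \<noteq> m"
    then have "lt x y" "x \<noteq> m"
      by (auto simp: lt_def)
    then show "y \<noteq> m \<and> \<not> covers T r y m \<and> x = p y"
      using middle(3,4)[of x y] p[of y] parent_unique[of x y "p y"] by auto
  qed (rule m(1))
qed

text \<open>The root goes to \<open>A\<close>, its covers go to level \<open>j\<close>, and the top
  elements to level \<open>l\<close>. As \<open>l\<close> is common to all branching sets, top
  elements with different parents still get images of equal size.\<close>

lemma increasing_tree_copy_of_branching: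
  fixes \<F> :: "nat set set"
  assumes T: "monotone_increasing_tree T r" "poset_height T r = 3"
    and \<F>: "\<And>B. B \<in> \<F> \<Longrightarrow> finite B" and A: "A \<in> \<F>"
    and branching: "card T \<le> card {B \<in> level_above \<F> A j. card T \<le> card (level_above \<F> B l)}"
  shows "\<exists>\<G>\<subseteq>\<F>. rank_preserving_copy T r \<G>"
proof -
  have fin: "finite T"
    using T(1) by (auto simp: monotone_increasing_tree_def tree_poset_def finite_poset_def)
  obtain m p where m: "m \<in> T"
    and parent: "\<And>y. \<lbrakk>y \<in> T; y \<noteq> m; \<not> covers T r y m\<rbrakk> \<Longrightarrow> covers T r (p y) m"
    and order: "\<And>x y. \<lbrakk>x \<in> T; y \<in> T; (x, y) \<in> r; x \<noteq> y; x \<noteq> m\<rbrakk>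
      \<Longrightarrow> y \<noteq> m \<and> \<not> covers T r y m \<and> x = p y"
    using increasing_tree_height_3_structure[OF T] by blast
  define V where "V = {x \<in> T. covers T r x m}"
  define W where "W = T - {m} - V"
  have m_notin: "m \<notin> V" "m \<notin> W"
    by (auto simp: V_def W_def covers_def)
  have T_split: "T = insert m (V \<union> W)" "V \<inter> W = {}"
    using m by (auto simp: V_def W_def)
  have pW: "p y \<in> V" if "y \<in> W" for y
    using parent[of y] that by (auto simp: V_def W_def covers_def)
  have below: "x = m \<or> (y \<in> W \<and> x = p y)" if "x \<in> T" "y \<in> T" "(x, y) \<in> r" "x \<noteq> y" for x y
    using order[of x y] that by (auto simp: V_def W_def)
  let ?\<B> = "{B \<in> level_above \<F> A j. card T \<le> card (level_above \<F> B l)}"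
  have "finite V" "finite W" "card V \<le> card T" "card W \<le> card T"
    using fin by (auto simp: V_def W_def intro: card_mono)
  have "\<exists>f. inj_on f V \<and> (\<forall>x\<in>V. f x \<in> ?\<B>)"
    by (rule injective_choice[OF \<open>finite V\<close> \<open>card V \<le> card T\<close> branching])
  then obtain f where f: "inj_on f V" "\<And>x. x \<in> V \<Longrightarrow> f x \<in> ?\<B>"
    by blast
  have "card T \<le> card (level_above \<F> (f (p y)) l)" if "y \<in> W" for y
    using f(2)[OF pW[OF that]] by simp
  \<comment> \<open>The choice runs over all of \<open>W\<close> at once, so images are distinct
    across different parents too.\<close>
  then have "\<exists>g. inj_on g W \<and> (\<forall>y\<in>W. g y \<in> level_above \<F> (f (p y)) l)"
    by (rule injective_choice[OF \<open>finite W\<close> \<open>card W \<le> card T\<close>])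
  then obtain g where g: "inj_on g W" "\<And>y. y \<in> W \<Longrightarrow> g y \<in> level_above \<F> (f (p y)) l"
    by blast
  define \<phi> where "\<phi> x = (if x = m then A else if x \<in> V then f x else g x)" for x
  define \<rho> :: "'a \<Rightarrow> int" where "\<rho> x = (if x = m then 0 else if x \<in> V then 1 else 2)" for x
  have \<phi>m: "\<phi> m = A" and \<phi>V: "x \<in> V \<Longrightarrow> \<phi> x = f x" and \<phi>W: "x \<in> W \<Longrightarrow> \<phi> x = g x" for x
    using m_notin T_split by (auto simp: \<phi>_def)
  have \<rho>m: "\<rho> m = 0" and \<rho>V: "x \<in> V \<Longrightarrow> \<rho> x = 1" and \<rho>W: "x \<in> W \<Longrightarrow> \<rho> x = 2" for x
    using m_notin T_split by (auto simp: \<rho>_def)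
  have fV: "f x \<in> \<F> \<and> A \<subset> f x \<and> card (f x) = j" if "x \<in> V" for x
    using f(2)[OF that] by (auto simp: level_above_def)
  have gW: "g y \<in> \<F> \<and> f (p y) \<subset> g y \<and> card (g y) = l" if "y \<in> W" for y
    using g(2)[OF that] by (auto simp: level_above_def)
  \<comment> \<open>Strict inclusions force \<open>card A < j < l\<close> for the ranks that occur,
    so injectivity of \<open>\<phi>\<close> need only be checked within a rank.\<close>
  have lt_V: "card A < j" if "x \<in> V" for x
    using fV[OF that] \<F> psubset_card_mono by metis
  have lt_W: "j < l" if "y \<in> W" for y
    using gW[OF that] fV[OF pW[OF that]] \<F> psubset_card_mono by metis
  have lt_W': "card A < l" if "y \<in> W" for y
    using lt_W[OF that] lt_V[OF pW[OF that]] by simp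
  have card_V: "card (\<phi> x) = j" if "x \<in> V" for x
    using fV[OF that] \<phi>V[OF that] by simp
  have card_W: "card (\<phi> x) = l" if "x \<in> W" for x
    using gW[OF that] \<phi>W[OF that] by simp
  have inj: "inj_on \<phi> T"
  proof (rule inj_onI)
    fix x y assume xy: "x \<in> T" "y \<in> T" "\<phi> x = \<phi> y"
    then have "card (\<phi> x) = card (\<phi> y)"
      by simp
    moreover have "x = m \<or> x \<in> V \<or> x \<in> W" "y = m \<or> y \<in> V \<or> y \<in> W"
      using xy T_split by auto
    ultimately consider "x = m" "y = m" | "x \<in> V" "y \<in> V" | "x \<in> W" "y \<in> W"
      using lt_V[of x] lt_V[of y] lt_W[of x] lt_W[of y] lt_W'[of x] lt_W'[of y]
        card_V[of x] card_V[of y] card_W[of x] card_W[of y] \<phi>m by force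
    then show "x = y"
      using xy(3) inj_onD[OF f(1), of x y] inj_onD[OF g(1), of x y] \<phi>V \<phi>W by cases simp_all
  qed
  have "\<phi> ` T \<subseteq> \<F>"
    using A fV gW unfolding T_split(1) by (auto simp: \<phi>m \<phi>V \<phi>W)
  moreover have "rank_preserving_copy T r (\<phi> ` T)"
    unfolding rank_preserving_copy_def
  proof (intro exI[of _ \<rho>] exI[of _ \<phi>] conjI ballI impI inj_on_imp_bij_betw inj)
    show "rank_function T r \<rho>"
      unfolding rank_function_def
    proof (intro allI impI)
      fix x y assume c: "covers T r y x"
      then have xy: "x \<in> T" "y \<in> T" "(x, y) \<in> r" "x \<noteq> y"
        by (auto simp: covers_def)
      from below[OF this] show "\<rho> y = \<rho> x + 1"
      proof
        assume "x = m"
        with c xy show ?thesis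
          using \<rho>V[of y] by (simp add: V_def \<rho>m)
      next
        assume "y \<in> W \<and> x = p y"
        then show ?thesis
          using \<rho>W[of y] \<rho>V[OF pW[of y]] by simp
      qed
    qed
  next
    fix x y assume that: "x \<in> T" "y \<in> T" "(x, y) \<in> r"
    show "\<phi> x \<subseteq> \<phi> y"
    proof (cases "x = y")
      case False
      with below that consider "x = m" | "y \<in> W" "x = p y"
        by blast
      then show ?thesis
      proof cases
        case 1
        have "A \<subseteq> f (p y)" if "y \<in> W"
          using fV[OF pW[OF that]] by auto
        moreover have "y = m \<or> y \<in> V \<or> y \<in> W"
          using that(2) T_split by auto
        ultimately have "A \<subseteq> \<phi> y"
          using fV[of y] gW[of y] \<phi>m \<phi>V[of y] \<phi>W[of y] by auto
        with 1 show ?thesis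
          by (simp add: \<phi>m)
      next
        case 2
        then show ?thesis
          using gW[of y] pW[of y] by (auto simp: \<phi>V \<phi>W)
      qed
    qed simp
  next
    fix x y assume that: "x \<in> T" "y \<in> T" "\<rho> x = \<rho> y"
    show "card (\<phi> x) = card (\<phi> y)"
    proof -
      have "x = m \<or> x \<in> V \<or> x \<in> W" "y = m \<or> y \<in> V \<or> y \<in> W"
        using that T_split by auto
      then show ?thesis
        using that(3) card_V card_W \<rho>m \<rho>V[of x] \<rho>V[of y] \<rho>W[of x] \<rho>W[of y] by auto
    qed
  qed
  ultimately show ?thesis
    by blast
qed

section \<open>Duality: reversing the order by complementation\<close>

lemma covers_converse: "covers P (r\<inverse>) y x \<longleftrightarrow> covers P r x y"
  unfolding covers_def by blast

lemma monotone_decreasing_tree_converse: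
  assumes "monotone_decreasing_tree P r"
  shows "monotone_increasing_tree P (r\<inverse>)"
proof -
  have "hasse_diagram P (r\<inverse>) = hasse_diagram P r"
    by (auto simp: hasse_diagram_def covers_converse)
  moreover have "minimal_element P (r\<inverse>) = maximal_element P r"
    by (auto simp: minimal_element_def maximal_element_def)
  moreover have "finite_poset P (r\<inverse>) \<longleftrightarrow> finite_poset P r"
    by (simp add: finite_poset_def)
  ultimately show ?thesis
    using assms by (simp add: monotone_increasing_tree_def monotone_decreasing_tree_def tree_poset_def)
qed

lemma poset_height_converse: "poset_height P (r\<inverse>) = poset_height P r"
proof -
  have "Chains (r\<inverse>) = Chains r"
    by (auto simp: Chains_def)
  then show ?thesis
    by (simp add: poset_height_def)
qed

text \<open>Complementation reverses inclusion and preserves equality of sizes. Passing to the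
  converse order swaps each cover, so the rank function is negated.\<close>

lemma rank_preserving_copy_complement:
  assumes copy: "rank_preserving_copy P (r\<inverse>) \<G>" and \<G>: "\<G> \<subseteq> Pow {1..n}"
  shows "rank_preserving_copy P r ((\<lambda>A. {1..n} - A) ` \<G>)"
proof -
  obtain \<rho> \<phi> where \<rho>: "rank_function P (r\<inverse>) \<rho>" and bij: "bij_betw \<phi> P \<G>"
    and mono: "\<forall>x\<in>P. \<forall>y\<in>P. (x, y) \<in> r\<inverse> \<longrightarrow> \<phi> x \<subseteq> \<phi> y"
    and card: "\<forall>x\<in>P. \<forall>y\<in>P. \<rho> x = \<rho> y \<longrightarrow> card (\<phi> x) = card (\<phi> y)"
    using copy by (auto simp: rank_preserving_copy_def)
  have sub: "\<phi> x \<subseteq> {1..n}" if "x \<in> P" for x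
    using bij \<G> that by (auto simp: bij_betw_def)
  have "bij_betw (\<lambda>A. {1..n} - A) \<G> ((\<lambda>A. {1..n} - A) ` \<G>)"
    using \<G> by (intro inj_on_imp_bij_betw) (auto simp: inj_on_def)
  with bij have "bij_betw (\<lambda>x. {1..n} - \<phi> x) P ((\<lambda>A. {1..n} - A) ` \<G>)"
    using bij_betw_trans[of \<phi> P \<G>] by (simp add: comp_def)
  moreover have "rank_function P r (\<lambda>x. - \<rho> x)"
    using \<rho> by (force simp: rank_function_def covers_converse)
  moreover have "\<forall>x\<in>P. \<forall>y\<in>P. (x, y) \<in> r \<longrightarrow> {1..n} - \<phi> x \<subseteq> {1..n} - \<phi> y"
    using mono by blast
  moreover have "\<forall>x\<in>P. \<forall>y\<in>P. - \<rho> x = - \<rho> y \<longrightarrow> card ({1..n} - \<phi> x) = card ({1..n} - \<phi> y)"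
  proof (intro ballI impI)
    fix x y assume xy: "x \<in> P" "y \<in> P" "- \<rho> x = - \<rho> y"
    have "card ({1..n} - \<phi> z) = n - card (\<phi> z)" if "z \<in> P" for z
      using card_Diff_subset[OF finite_subset[OF sub[OF that]] sub[OF that]] by simp
    then show "card ({1..n} - \<phi> x) = card ({1..n} - \<phi> y)"
      using bspec[OF bspec[OF card xy(1)] xy(2)] xy by simp
  qed
  ultimately show ?thesis
    unfolding rank_preserving_copy_def by (intro exI[of _ "\<lambda>x. - \<rho> x"] exI[of _ "\<lambda>x. {1..n} - \<phi> x"] conjI)
qed

section \<open>Concentration on the middle levels, and the size bound\<close>

lemma card_subsets_card_in:
  assumes "finite S"
  shows "card {A \<in> Pow S. card A \<in> X} = (\<Sum>k\<in>X \<inter> {..card S}. card S choose k)"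
proof -
  have "{A \<in> Pow S. card A \<in> X} = (\<Union>k\<in>X \<inter> {..card S}. {A. A \<subseteq> S \<and> card A = k})"
    using assms by (auto intro: card_mono)
  also have "card \<dots> = (\<Sum>k\<in>X \<inter> {..card S}. card {A. A \<subseteq> S \<and> card A = k})"
    using assms by (intro card_UN_disjoint) auto
  finally show ?thesis
    using assms by (simp add: n_subsets)
qed

text \<open>The size of a uniformly random subset is binomial with parameters \<open>n\<close> and
  \<open>1 / 2\<close>, so Hoeffding's inequality applies.\<close>

lemma card_subsets_far_from_middle:
  assumes "0 < n" "0 \<le> \<epsilon>"
  shows "real (card {A \<in> Pow {1..n}. \<epsilon> \<le> \<bar>real (card A) - real n / 2\<bar>}) \<le> 2 ^ n * (2 * exp (- 2 * \<epsilon>\<^sup>2 / n))"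
proof -
  interpret binomial_distribution n "1 / 2"
    by unfold_locales auto
  let ?X = "{k::nat. \<epsilon> \<le> \<bar>real k - real n * (1 / 2)\<bar>}"
  let ?p = "binomial_pmf n (1 / 2)"
  have "measure_pmf.prob ?p ?X = measure_pmf.prob ?p (?X \<inter> set_pmf ?p)"
    by (rule measure_Int_set_pmf[symmetric])
  also have "\<dots> = (\<Sum>k\<in>?X \<inter> {..n}. pmf ?p k)"
    by (subst measure_measure_pmf_finite) auto
  also have "\<dots> = (\<Sum>k\<in>?X \<inter> {..n}. real (n choose k) / 2 ^ n)"
    by (intro sum.cong) (auto simp: power_one_over field_simps simp flip: power_add)
  also have "\<dots> = real (card {A \<in> Pow {1..n}. card A \<in> ?X}) / 2 ^ n"
    using card_subsets_card_in[of "{1..n}" ?X] by (simp add: sum_divide_distrib)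
  finally have "real (card {A \<in> Pow {1..n}. card A \<in> ?X}) / 2 ^ n \<le> 2 * exp (- 2 * \<epsilon>\<^sup>2 / n)"
    using prob_abs_ge[OF assms] by simp
  then show ?thesis
    by (simp add: field_simps)
qed

text \<open>The largest of the \<open>n + 1\<close> levels is at least average. The lost factor
  \<open>n + 1\<close> is harmless against a tail of order \<open>1 / n^2\<close>.\<close>

lemma two_power_le_central_binomial: "(2::nat) ^ n \<le> (n + 1) * (n choose (n div 2))"
proof -
  have "(2::nat) ^ n = (\<Sum>k\<le>n. n choose k)"
    by (simp add: choose_row_sum)
  also have "\<dots> \<le> (\<Sum>k\<le>n. n choose (n div 2))"
    by (intro sum_mono binomial_maximum)
  finally show ?thesis
    by simp
qed

lemma card_le_lubell_mult_central_binomial: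
  assumes "finite S" "\<F> \<subseteq> Pow S"
  shows "real (card \<F>) \<le> lubell (card S) \<F> * real (card S choose (card S div 2))"
proof -
  have "1 \<le> 1 / real (card S choose card A) * real (card S choose (card S div 2))" if "A \<in> \<F>" for A
  proof -
    have "card A \<le> card S"
      using that assms by (auto intro: card_mono)
    then show ?thesis
      using binomial_maximum[of "card S" "card A"] by (simp add: field_simps)
  qed
  then have "(\<Sum>A\<in>\<F>. 1) \<le> (\<Sum>A\<in>\<F>. 1 / real (card S choose card A) * real (card S choose (card S div 2)))"
    by (intro sum_mono) auto
  then show ?thesis
    by (simp add: lubell_def sum_distrib_right)
qed

text \<open>Members near the middle are bounded through the Lubell mass, the others through
  Hoeffding. The threshold for \<open>n\<close> is uniform in the family, so the bound applies to an
  extremal family for each large \<open>n\<close>.\<close>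

lemma no_branching_card_le:
  fixes K :: nat
  shows "\<exists>C\<ge>0. \<forall>\<^sub>F n in sequentially. \<forall>\<F>\<subseteq>Pow {1..n}.
    (\<forall>A\<in>\<F>. \<forall>j l. card {B \<in> level_above \<F> A j. K \<le> card (level_above \<F> B l)} < K) \<longrightarrow>
    real (card \<F>) \<le> (2 + C * sqrt (ln (real n) / real n)) * real (n choose (n div 2))"
proof -
  \<comment> \<open>\<open>6440 = 40 + 6400\<close>, the two coefficients that arise below once
    \<open>t^2\<close> is replaced by \<open>t\<close>.\<close>
  define D where "D = 6440 * real K"
  have "((\<lambda>n. D * sqrt (ln (real n) / real n)) \<longlongrightarrow> 0) sequentially"
    by (intro tendsto_mult_right_zero) real_asymp
  then have ev1: "\<forall>\<^sub>F n in sequentially. D * sqrt (ln (real n) / real n) < 1 / 2"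
    by (rule order_tendstoD) simp
  have ev2: "\<forall>\<^sub>F n in sequentially. sqrt (real n * ln (real n)) + 1 \<le> real n / 4"
    by real_asymp
  have ev3: "\<forall>\<^sub>F n in sequentially. 1 \<le> sqrt (real n * ln (real n))"
    by real_asymp
  have ev4: "\<forall>\<^sub>F n in sequentially. 1 / real n \<le> sqrt (ln (real n) / real n)"
    by real_asymp
  have ev5: "\<forall>\<^sub>F n in sequentially. sqrt (ln (real n) / real n) \<le> 1"
    by real_asymp
  have "\<forall>\<^sub>F n in sequentially. \<forall>\<F>\<subseteq>Pow {1..n}.
    (\<forall>A\<in>\<F>. \<forall>j l. card {B \<in> level_above \<F> A j. K \<le> card (level_above \<F> B l)} < K) \<longrightarrow>
    real (card \<F>) \<le> (2 + (4 * D + 4) * sqrt (ln (real n) / real n)) * real (n choose (n div 2))"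
    using ev1 ev2 ev3 ev4 ev5 eventually_ge_at_top[of 16]
  proof eventually_elim
    case (elim n)
    define t where "t = sqrt (ln (real n) / real n)"
    \<comment> \<open>The half-width of the window of levels: it makes the Hoeffding factor
      \<open>exp (- 2 * s^2 / n)\<close> equal to \<open>1 / n^2\<close>, and
      \<open>s / n = t\<close>.\<close>
    define s where "s = sqrt (real n * ln (real n))"
    define b where "b = real (n choose (n div 2))"
    have n: "16 \<le> real n" "16 \<le> n"
      using elim by auto
    have s_sq: "s\<^sup>2 = real n * ln (real n)"
      using n by (simp add: s_def)
    have s_t: "s = real n * t"
    proof -
      have "real n * ln (real n) = (real n)\<^sup>2 * (ln (real n) / real n)"
        using n by (simp add: power2_eq_square)
      then have "s = sqrt ((real n)\<^sup>2) * t"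
        unfolding s_def t_def real_sqrt_mult[symmetric] by (rule arg_cong)
      then show ?thesis
        by simp
    qed
    have t: "0 \<le> t" "t \<le> 1" "1 / real n \<le> t" "D * t < 1 / 2"
      using elim n by (auto simp: t_def)
    have s: "1 \<le> s" "s + 1 \<le> real n / 4"
      using elim by (auto simp: s_def)
    show ?case
    proof (intro allI impI)
      fix \<F> assume \<F>: "\<F> \<subseteq> Pow {1..n}"
        and free: "\<forall>A\<in>\<F>. \<forall>j l. card {B \<in> level_above \<F> A j. K \<le> card (level_above \<F> B l)} < K"
      define N where "N = {A \<in> \<F>. \<bar>real (card A) - real n / 2\<bar> < s}"
      have fin: "finite \<F>"
        using \<F> by (auto intro: finite_subset)
      have N: "N \<subseteq> \<F>" "N \<subseteq> Pow {1..n}"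
        using \<F> by (auto simp: N_def)
      \<comment> \<open>The margin between the window and the top level, guaranteed by
        \<open>s + 1 \<le> n / 4\<close>.\<close>
      define M where "M = n div 4"
      define I where "I = {nat \<lfloor>real n / 2 - s\<rfloor>..nat \<lceil>real n / 2 + s\<rceil>}"
      \<comment> \<open>Outward rounding leaves at most \<open>2 * s + 3\<close> levels, and
        \<open>1 \<le> s\<close> absorbs the constant.\<close>
      have card_I: "real (card I) \<le> 5 * s"
        using s n unfolding I_def by simp linarith
      have I_N: "card ` N \<subseteq> I"
      proof (rule image_subsetI)
        fix A assume "A \<in> N"
        then have "\<bar>real (card A) - real n / 2\<bar> < s"
          by (simp add: N_def)
        then show "card A \<in> I"
          unfolding I_def by simp linarith
      qed
      have I_M: "i + M \<le> card {1..n}" if "i \<in> I" for i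
      proof -
        have "real i \<le> real n / 2 + s + 1"
          using that s n unfolding I_def by simp linarith
        moreover have "real M \<le> real n / 4"
          unfolding M_def by linarith
        ultimately have "real (i + M) \<le> real n"
          using s(2) by simp
        then show ?thesis
          by simp
      qed
      have M: "real n / 8 \<le> real M" "2 \<le> M"
        using n unfolding M_def by linarith+
      \<comment> \<open>For \<open>n \<ge> 16\<close>, the bound \<open>n / 8 \<le> M\<close> gives
        \<open>n / 16 \<le> M - 1\<close>.\<close>
      have M2: "(real n)\<^sup>2 / 256 \<le> real (M choose 2)"
      proof -
        have "(real n / 8) * (real n / 16) \<le> real M * (real M - 1)"
          using M n by (intro mult_mono) auto
        also have "\<dots> = 2 * real (M choose 2)"
        proof -
          have "real (2 * (M choose 2)) = real (M * (M - 1))"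
            by (intro arg_cong[where f = real]) (cases M; simp add: choose_two)
          then show ?thesis
            using M(2) by (simp add: of_nat_diff)
        qed
        finally show ?thesis
          by (simp add: power2_eq_square)
      qed
      \<comment> \<open>Absence of branching passes to subfamilies, since all the counts can only
        decrease.\<close>
      have free_N: "card {B \<in> level_above N A j. K \<le> card (level_above N B l)} < K" if "A \<in> N" for A j l
      proof -
        have mono: "level_above N B i \<subseteq> level_above \<F> B i" for B i
          using N by (auto simp: level_above_def)
        have fin': "finite (level_above \<F> B i)" for B i
          using fin by (simp add: level_above_def)
        have "card (level_above N B i) \<le> card (level_above \<F> B i)" for B i
          by (intro card_mono fin' mono)
        then have "{B \<in> level_above N A j. K \<le> card (level_above N B l)} \<subseteq>
            {B \<in> level_above \<F> A j. K \<le> card (level_above \<F> B l)}"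
          using mono le_trans by blast
        then have "card {B \<in> level_above N A j. K \<le> card (level_above N B l)} \<le>
            card {B \<in> level_above \<F> A j. K \<le> card (level_above \<F> B l)}"
          by (intro card_mono) (simp_all add: fin')
        also have "\<dots> < K"
          using free that N by blast
        finally show ?thesis .
      qed
      let ?L = "lubell n N"
      have L0: "0 \<le> ?L"
        by (simp add: lubell_def sum_nonneg)
      have "real (K * card I) / M + real (K * (card I)\<^sup>2) / (M choose 2)
          \<le> (K * (5 * s)) / (real n / 8) + (K * (5 * s)\<^sup>2) / ((real n)\<^sup>2 / 256)"
        using card_I M M2 n s unfolding of_nat_mult of_nat_power
        by (intro add_mono frac_le mult_left_mono power_mono) auto
      also have "\<dots> = K * (40 * t + 6400 * t\<^sup>2)"
        using n by (simp add: s_t power_mult_distrib field_simps)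
      also have "\<dots> \<le> K * (40 * t + 6400 * t)"
        using t by (intro mult_left_mono add_mono) (auto simp: power2_eq_square mult_left_le)
      also have "\<dots> = D * t"
        by (simp add: D_def)
      finally have \<epsilon>: "real (K * card I) / M + real (K * (card I)\<^sup>2) / (M choose 2) \<le> D * t" .
      have "?L \<le> 2 + ?L * (real (K * card I) / M + real (K * (card I)\<^sup>2) / (M choose 2))"
        using lubell_no_branching[OF _ N(2) _ I_N I_M M(2) free_N] by (simp add: I_def)
      also have "\<dots> \<le> 2 + ?L * (D * t)"
        by (intro add_left_mono mult_left_mono \<epsilon> L0)
      finally have L_le: "?L \<le> 2 + ?L * (D * t)" .
      have Dt: "0 \<le> D * t"
        using t by (simp add: D_def)
      \<comment> \<open>Bootstrapping: \<open>D * t < 1 / 2\<close> first gives the crude bound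
        \<open>4\<close>, which is then inserted into the error term of \<open>L_le\<close>.\<close>
      have "?L * (D * t) \<le> ?L * (1 / 2)"
        using L0 t by (intro mult_left_mono) auto
      with L_le have "?L \<le> 4"
        by simp
      then have "?L * (D * t) \<le> 4 * (D * t)"
        using Dt by (rule mult_right_mono)
      with L_le have "?L \<le> 2 + 4 * D * t"
        by simp
      then have "?L * b \<le> (2 + 4 * D * t) * b"
        by (intro mult_right_mono) (auto simp: b_def)
      moreover have "real (card N) \<le> ?L * b"
        using card_le_lubell_mult_central_binomial[OF _ N(2)] by (simp add: b_def)
      ultimately have near: "real (card N) \<le> (2 + 4 * D * t) * b"
        by simp
      have "card (\<F> - N) \<le> card {A \<in> Pow {1..n}. s \<le> \<bar>real (card A) - real n / 2\<bar>}"
        using \<F> by (intro card_mono) (auto simp: N_def)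
      also have "real \<dots> \<le> 2 ^ n * (2 * exp (- 2 * s\<^sup>2 / n))"
        using n s by (intro card_subsets_far_from_middle) auto
      also have "exp (- 2 * s\<^sup>2 / n) = 1 / (real n)\<^sup>2"
      proof -
        have "exp (- 2 * s\<^sup>2 / n) = exp (- (ln (real n) + ln (real n)))"
          using n by (simp add: s_sq)
        also have "\<dots> = 1 / (real n)\<^sup>2"
          unfolding exp_minus exp_add using n by (simp add: power2_eq_square divide_inverse)
        finally show ?thesis .
      qed
      also have "2 ^ n * (2 * (1 / (real n)\<^sup>2)) \<le> (real (n + 1) * b) * (2 * (1 / (real n)\<^sup>2))"
        using of_nat_mono[OF two_power_le_central_binomial[of n], where 'a = real]
        by (intro mult_right_mono) (auto simp: b_def distrib_right)
      also have "\<dots> = (2 * real (n + 1) / (real n)\<^sup>2) * b"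
        by simp
      also have "\<dots> \<le> (4 * t) * b"
      proof (intro mult_right_mono)
        have "2 * real (n + 1) / (real n)\<^sup>2 \<le> (4 * real n) / (real n)\<^sup>2"
          using n by (intro divide_right_mono) auto
        also have "\<dots> = 4 * (1 / real n)"
          by (simp add: power2_eq_square)
        finally show "2 * real (n + 1) / (real n)\<^sup>2 \<le> 4 * t"
          using t by linarith
      qed (simp add: b_def)
      finally have far: "real (card (\<F> - N)) \<le> 4 * t * b"
        by simp
      have "card \<F> = card N + card (\<F> - N)"
        using N fin by (metis card_Diff_subset card_mono finite_subset le_add_diff_inverse)
      then show "real (card \<F>) \<le> (2 + (4 * D + 4) * sqrt (ln (real n) / real n)) * real (n choose (n div 2))"
        using near far unfolding t_def[symmetric] b_def[symmetric] by (simp add: algebra_simps)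
    qed
  qed
  then show ?thesis
    by (intro exI[of _ "4 * D + 4"]) (simp add: D_def)
qed

section \<open>Attainment of the extremal number and the lower bound\<close>

lemma card_le_La_rp:
  assumes "\<F> \<subseteq> Pow {1..n}" "\<not> (\<exists>\<G>. \<G> \<subseteq> \<F> \<and> rank_preserving_copy P r \<G>)"
  shows "card \<F> \<le> La_rp n P r"
  unfolding La_rp_def using assms by (intro Max_ge finite_imageI imageI) auto

text \<open>The empty family contains no copy of a nonempty poset, so the maximum is taken over a
  nonempty set.\<close>

lemma La_rp_attained:
  assumes "P \<noteq> {}"
  obtains \<F> where "\<F> \<subseteq> Pow {1..n}" "card \<F> = La_rp n P r"
    "\<not> (\<exists>\<G>. \<G> \<subseteq> \<F> \<and> rank_preserving_copy P r \<G>)"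
proof -
  let ?X = "{\<F>. \<F> \<subseteq> Pow {1..n} \<and> \<not> (\<exists>\<G>. \<G> \<subseteq> \<F> \<and> rank_preserving_copy P r \<G>)}"
  have "\<not> rank_preserving_copy P r {}"
    using assms by (auto simp: rank_preserving_copy_def bij_betw_def)
  then have "{} \<in> ?X"
    by auto
  then have "La_rp n P r \<in> card ` ?X"
    unfolding La_rp_def by (intro Max_in) auto
  then obtain \<F> where "La_rp n P r = card \<F>" "\<F> \<in> ?X"
    by (elim imageE)
  then show thesis
    by (intro that[of \<F>]) auto
qed

text \<open>The images of a chain are comparable and distinct, hence of distinct sizes, while two
  levels offer only two sizes.\<close>

lemma La_rp_ge_two_levels:
  assumes "finite P" "3 \<le> poset_height P r"
  shows "(n choose k) + (n choose (k + 1)) \<le> La_rp n P r"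
proof -
  let ?\<F> = "{A \<in> Pow {1..n}. card A \<in> {k, k + 1}}"
  have "False" if \<G>: "\<G> \<subseteq> ?\<F>" "rank_preserving_copy P r \<G>" for \<G>
  proof -
    obtain \<phi> where bij: "bij_betw \<phi> P \<G>" and mono: "\<And>x y. x \<in> P \<Longrightarrow> y \<in> P \<Longrightarrow> (x, y) \<in> r \<Longrightarrow> \<phi> x \<subseteq> \<phi> y"
      using \<G>(2) by (auto simp: rank_preserving_copy_def)
    obtain C where C: "C \<subseteq> P" "C \<in> Chains r" "card C = poset_height P r"
      using height_chain_exists[OF assms(1)] by blast
    have \<phi>: "\<phi> x \<subseteq> {1..n}" "card (\<phi> x) \<in> {k, k + 1}" if "x \<in> C" for x
    proof -
      have "\<phi> x \<in> ?\<F>"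
        using that C(1) bij \<G>(1) by (auto simp: bij_betw_def)
      then show "\<phi> x \<subseteq> {1..n}" "card (\<phi> x) \<in> {k, k + 1}"
        by auto
    qed
    have "inj_on (\<lambda>x. card (\<phi> x)) C"
    proof (rule inj_onI)
      fix x y assume xy: "x \<in> C" "y \<in> C" "card (\<phi> x) = card (\<phi> y)"
      have "(x, y) \<in> r \<or> (y, x) \<in> r"
        using C(2) xy by (auto simp: Chains_def)
      then have "\<phi> x \<subseteq> \<phi> y \<or> \<phi> y \<subseteq> \<phi> x"
        using mono xy C(1) by blast
      moreover have "finite (\<phi> x)" "finite (\<phi> y)"
        using \<phi>(1) xy finite_subset by blast+
      ultimately have "\<phi> x = \<phi> y"
        using xy(3) card_subset_eq by metis
      then show "x = y"
        using bij xy C(1) by (auto simp: bij_betw_def dest: inj_onD)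
    qed
    then have "card C \<le> card {k, k + 1}"
      using \<phi>(2) by (intro card_inj_on_le[of "\<lambda>x. card (\<phi> x)"]) auto
    then show False
      using C(3) assms(2) by simp
  qed
  then have "card ?\<F> \<le> La_rp n P r"
    by (intro card_le_La_rp) blast+
  moreover have "card ?\<F> = (\<Sum>j\<in>{k, k + 1} \<inter> {..n}. n choose j)"
    using card_subsets_card_in[of "{1..n}" "{k, k + 1}"] by simp
  \<comment> \<open>An index above \<open>n\<close> contributes a zero binomial.\<close>
  moreover have "\<dots> = (\<Sum>j\<in>{k, k + 1}. n choose j)"
    by (intro sum.mono_neutral_left) (auto simp: binomial_eq_0)
  ultimately show ?thesis
    by simp
qed

text \<open>With \<open>m = n div 2\<close>, the ratio of the two binomials is
  \<open>(n - m) / (m + 1)\<close>, which is at least \<open>1 - 1 / (m + 1)\<close>, and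
  \<open>n \<le> 2 * (m + 1)\<close>.\<close>

lemma binomial_Suc_central_ge:
  assumes "0 < n"
  shows "(1 - 2 / real n) * real (n choose (n div 2)) \<le> real (n choose (n div 2 + 1))"
proof -
  let ?m = "n div 2"
  have "Suc ?m * (n choose Suc ?m) = (n - ?m) * (n choose ?m)"
    by (simp only: binomial_absorption binomial_absorb_comp)
  then have "real (Suc ?m * (n choose Suc ?m)) = real ((n - ?m) * (n choose ?m))"
    by (rule arg_cong)
  then have absorb: "real (n - ?m) * real (n choose ?m) = real (n choose (?m + 1)) * real (?m + 1)"
    unfolding of_nat_mult by (simp only: Suc_eq_plus1 mult.commute)
  have "1 \<le> 2 / real n * real (?m + 1)"
  proof -
    have "n \<le> 2 * (?m + 1)"
      by presburger
    then have "real n \<le> real (2 * (?m + 1))"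
      by (rule of_nat_mono)
    then show ?thesis
      using assms by (simp add: pos_le_divide_eq)
  qed
  moreover have "real ?m \<le> real (n - ?m)"
    by simp
  ultimately have "(1 - 2 / real n) * real (?m + 1) \<le> real (n - ?m)"
    unfolding left_diff_distrib by simp
  then have "(1 - 2 / real n) * real (?m + 1) * real (n choose ?m) \<le> real (n - ?m) * real (n choose ?m)"
    by (rule mult_right_mono) simp
  then have "(1 - 2 / real n) * real (n choose ?m) * real (?m + 1) \<le> real (n choose (?m + 1)) * real (?m + 1)"
    unfolding absorb by (simp only: mult_ac)
  then show ?thesis
    by (rule mult_right_le_imp_le) simp
qed

section \<open>Reduction to increasing trees and the final estimate\<close>

lemma branching_free_of_increasing_tree_free:
  assumes T: "monotone_increasing_tree T r" "poset_height T r = 3"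
    and \<F>: "\<F> \<subseteq> Pow {1..n}" and free: "\<not> (\<exists>\<G>. \<G> \<subseteq> \<F> \<and> rank_preserving_copy T r \<G>)"
    and "A \<in> \<F>"
  shows "card {B \<in> level_above \<F> A j. card T \<le> card (level_above \<F> B l)} < card T"
proof (rule ccontr)
  have "finite B" if "B \<in> \<F>" for B
    using \<F> that by (auto intro: finite_subset)
  moreover assume "\<not> ?thesis"
  ultimately have "\<exists>\<G>\<subseteq>\<F>. rank_preserving_copy T r \<G>"
    by (intro increasing_tree_copy_of_branching[OF T _ \<open>A \<in> \<F>\<close>, of j l]) auto
  then show False
    using free by blast
qed

text \<open>A decreasing tree is handled by complementing the family, which keeps its size. Both
  kinds of tree thus lead to one branching condition, in which only \<open>card T\<close>
  survives.\<close>

lemma monotone_tree_free_branching_free: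
  assumes T: "monotone_tree T r" "poset_height T r = 3"
    and \<F>: "\<F> \<subseteq> Pow {1..n}" and free: "\<not> (\<exists>\<G>. \<G> \<subseteq> \<F> \<and> rank_preserving_copy T r \<G>)"
  obtains \<F>' where "\<F>' \<subseteq> Pow {1..n}" "card \<F>' = card \<F>"
    "\<forall>A\<in>\<F>'. \<forall>j l. card {B \<in> level_above \<F>' A j. card T \<le> card (level_above \<F>' B l)} < card T"
proof (cases "monotone_increasing_tree T r")
  case True
  show thesis
    by (rule that[OF \<F> refl]) (intro ballI allI branching_free_of_increasing_tree_free[OF True T(2) \<F> free])
next
  case False
  then have T': "monotone_increasing_tree T (r\<inverse>)" "poset_height T (r\<inverse>) = 3"
    using T by (auto simp: monotone_tree_def poset_height_converse intro: monotone_decreasing_tree_converse)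
  let ?c = "\<lambda>A. {1..n} - A"
  have "inj_on ?c \<F>"
    using \<F> by (auto simp: inj_on_def)
  then have card: "card (?c ` \<F>) = card \<F>"
    by (rule card_image)
  have sub: "?c ` \<F> \<subseteq> Pow {1..n}"
    by auto
  have "False" if \<G>: "\<G> \<subseteq> ?c ` \<F>" "rank_preserving_copy T (r\<inverse>) \<G>" for \<G>
  proof -
    \<comment> \<open>Complementation is an involution on subsets of \<open>{1..n}\<close>, so a
      copy of the converse tree among the complements yields a copy of \<open>T\<close> in the
      original family.\<close>
    have "?c ` \<G> \<subseteq> ?c ` ?c ` \<F>"
      using \<G>(1) by (rule image_mono)
    also have "\<dots> = \<F>"
    proof -
      have "?c (?c A) = A" if "A \<in> \<F>" for A
        using \<F> that by auto
      then show ?thesis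
        by (simp add: image_image)
    qed
    finally show False
      using free rank_preserving_copy_complement[OF \<G>(2)] \<G>(1) sub by blast
  qed
  then have free': "\<not> (\<exists>\<G>. \<G> \<subseteq> ?c ` \<F> \<and> rank_preserving_copy T (r\<inverse>) \<G>)"
    by blast
  show thesis
    by (rule that[OF sub card]) (intro ballI allI branching_free_of_increasing_tree_free[OF T' sub free'])
qed

theorem theorem1p3:
  fixes T :: "'a set" and r :: "'a rel"
  assumes "monotone_tree T r"
    and "poset_height T r = 3"
  shows "\<exists>C::real. \<forall>\<^sub>F n in sequentially.
    \<bar>real (La_rp n T r) / real (n choose (n div 2)) - 2\<bar> \<le> C * sqrt (ln (real n) / real n)"
proof -
  have T: "finite T" "T \<noteq> {}"
    using assms(1) unfolding monotone_tree_def monotone_increasing_tree_def monotone_decreasing_tree_def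
      tree_poset_def finite_poset_def graph_tree_def by auto
  obtain C where C: "0 \<le> C" "\<forall>\<^sub>F n in sequentially. \<forall>\<F>\<subseteq>Pow {1..n}.
    (\<forall>A\<in>\<F>. \<forall>j l. card {B \<in> level_above \<F> A j. card T \<le> card (level_above \<F> B l)} < card T) \<longrightarrow>
    real (card \<F>) \<le> (2 + C * sqrt (ln (real n) / real n)) * real (n choose (n div 2))"
    using no_branching_card_le by blast
  have ev: "\<forall>\<^sub>F n in sequentially. 2 / real n \<le> sqrt (ln (real n) / real n)"
    by real_asymp
  have "\<forall>\<^sub>F n in sequentially.
    \<bar>real (La_rp n T r) / real (n choose (n div 2)) - 2\<bar> \<le> (C + 1) * sqrt (ln (real n) / real n)"
    using C(2) ev eventually_gt_at_top[of 0]
  proof eventually_elim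
    case (elim n)
    define t where "t = sqrt (ln (real n) / real n)"
    define b where "b = real (n choose (n div 2))"
    have b: "0 < b"
      by (simp add: b_def)
    have t: "2 / real n \<le> t"
      using elim(2) by (simp add: t_def)
    moreover have "0 \<le> 2 / real n"
      by simp
    ultimately have t0: "0 \<le> t"
      by linarith
    obtain \<F> where \<F>: "\<F> \<subseteq> Pow {1..n}" "card \<F> = La_rp n T r"
      and free: "\<not> (\<exists>\<G>. \<G> \<subseteq> \<F> \<and> rank_preserving_copy T r \<G>)"
      using La_rp_attained[OF T(2)] by blast
    obtain \<F>' where \<F>': "\<F>' \<subseteq> Pow {1..n}" "card \<F>' = card \<F>"
      "\<forall>A\<in>\<F>'. \<forall>j l. card {B \<in> level_above \<F>' A j. card T \<le> card (level_above \<F>' B l)} < card T"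
      using monotone_tree_free_branching_free[OF assms \<F>(1) free] by blast
    then have "real (card \<F>') \<le> (2 + C * t) * b"
      unfolding t_def b_def using elim(1) by blast
    then have "real (La_rp n T r) \<le> (2 + C * t) * b"
      using \<F>(2) \<F>'(2) by simp
    then have upper: "real (La_rp n T r) / b \<le> 2 + C * t"
      using b by (simp add: pos_divide_le_eq)
    have "(2 - t) * b \<le> (1 + (1 - 2 / real n)) * b"
      using t b by (intro mult_right_mono) auto
    also have "\<dots> = b + (1 - 2 / real n) * b"
      by (simp only: distrib_right mult_1)
    also have "\<dots> \<le> b + real (n choose (n div 2 + 1))"
      using binomial_Suc_central_ge[OF elim(3)] by (simp add: b_def)
    also have "\<dots> \<le> real (La_rp n T r)"
      using La_rp_ge_two_levels[of T r n "n div 2"] T(1) assms(2)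
      unfolding b_def by (simp flip: of_nat_add)
    finally have "2 - t \<le> real (La_rp n T r) / b"
      using b by (simp add: pos_le_divide_eq)
    \<comment> \<open>The deviation is at most \<open>C * t\<close> upwards and \<open>t\<close>
      downwards; both are nonnegative, so \<open>C + 1\<close> serves for either side.\<close>
    then have "\<bar>real (La_rp n T r) / b - 2\<bar> \<le> (C + 1) * t"
      using upper t0 mult_nonneg_nonneg[OF C(1) t0] by (simp add: abs_le_iff distrib_right)
    then show ?case
      by (simp add: t_def b_def)
  qed
  then show ?thesis
    by blast
qed

end
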